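(* Let $\mathcal{X}=\{x_1,\dots,x_s\}$ be a finite set ($s<\infty$) with a pre-order $\preceq$, let $\bm{w}=(w_1,\dots,w_s)$ be a fixed vector of strictly positive weights, and let $\mathring{\bm{g}}\in\mathbb{R}^s$ be isotonic. Let $\hat{\bm{g}}_n$, $n\ge 1$, be random vectors in $\mathbb{R}^s$ such that $\hat{\bm{g}}_n\stackrel{p}{\to}\mathring{\bm{g}}$ and $B_n(\hat{\bm{g}}_n-\mathring{\bm{g}})\stackrel{d}{\to}\bm{\lambda}$, where $\bm{\lambda}$ is a random vector in $\mathbb{R}^s$ and $B_n$ is the diagonal $s\times s$ matrix with entries $[B_n]_{ii}=n^{q_i}$, the $q_i$ being positive real numbers such that $q_{i_1}=q_{i_2}$ whenever $x_{i_1}$ and $x_{i_2}$ belong to the same comparable level set of $\mathring{\bm{g}}$. Let $\hat{\bm{g}}_n^{*}$ be the isotonic regression of $\hat{\bm{g}}_n$ over $\mathcal{X}$ with weights $\bm{w}$. Then $$B_n(\hat{\bm{g}}_n^{*}-\mathring{\bm{g}})\stackrel{d}{\to}\varphi(\bm{\lambda}),\qquad n\to\infty,$$ where $\varphi:\mathbb{R}^s\to\mathbb{R}^s$ maps $\bm{\theta}$ to the concatenation of the isotonic regressions (with weights $\bm{w}$) of the restrictions of $\bm{\theta}$ to the comparable level sets of $\mathring{\bm{g}}$.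
   Context: A pre-order is a reflexive and transitive relation (not necessarily antisymmetric or total). Two elements $x,y$ are comparable, $x\sim y$, if $x\preceq y$ or $y\preceq x$. A vector $\bm{\theta}\in\mathbb{R}^s$ is identified with the function $\theta(x_i)=\theta_i$ on $\mathcal{X}$. A function $f$ on a subset $A\subseteq\mathcal{X}$ is isotonic if $x,y\in A$, $x\preceq y$ imply $f(x)\le f(y)$. The isotonic regression of a function $\theta$ over $A\subseteq\mathcal{X}$ with positive weights $\bm{w}$ is the (unique) minimizer of $\sum_{x\in A}(f(x)-\theta(x))^2w_x$ over isotonic functions $f$ on $A$, where $w_{x_i}=w_i$. Comparable level sets of an isotonic $\mathring{g}$: first partition $\mathcal{X}=\cup_{v=1}^k\mathcal{X}^{(v)}$ into the connected components of the graph on $\mathcal{X}$ whose edges join comparable elements. Within each $\mathcal{X}^{(v)}$ take the level sets of $\mathring{g}$ (the nonempty sets $\{x\in\mathcal{X}^{(v)}:\mathring{g}(x)=c\}$), and partition each level set into the connected components of the comparability graph restricted to that level set. The resulting sets $\mathcal{X}^{(v,l)}$, $l=1,\dots,m_v$, $v=1,\dots,k$, are the comparable level sets of $\mathring{g}$; they partition $\mathcal{X}$. Operator $\varphi$: for $\bm{\theta}\in\mathbb{R}^s$, $\varphi(\bm{\theta})_i=\theta^{*(v',l')}(x_i)$, where $(v',l')$ is the unique pair with $x_i\in\mathcal{X}^{(v',l')}$ and $\theta^{*(v',l')}$ is the isotonic regression over $\mathcal{X}^{(v',l')}$ with weights $\bm{w}$ of the restriction of $\theta$ to $\mathcal{X}^{(v',l')}$.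 *)

theory Defs
  imports "HOL-Probability.Probability"
begin

definition comparable :: "('x \<Rightarrow> 'x \<Rightarrow> bool) \<Rightarrow> 'x \<Rightarrow> 'x \<Rightarrow> bool" where
  "comparable le x y \<longleftrightarrow> le x y \<or> le y x"

definition comparable_components :: "('x \<Rightarrow> 'x \<Rightarrow> bool) \<Rightarrow> 'x set \<Rightarrow> 'x set set" where
  "comparable_components le A = A // {(x, y). x \<in> A \<and> y \<in> A \<and> comparable le x y}\<^sup>*"

text \<open>An empty level set has no components, so only nonempty level sets contribute.\<close>

definition comparable_level_sets :: "('x \<Rightarrow> 'x \<Rightarrow> bool) \<Rightarrow> ('x \<Rightarrow> real) \<Rightarrow> 'x set set" where
  "comparable_level_sets le g =
     (\<Union>V \<in> comparable_components le UNIV. \<Union>c. comparable_components le {x \<in> V. g x = c})"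

text \<open>
  A function on \<open>A\<close> is represented by its extension with value \<open>undefined\<close> outside \<open>A\<close>;
  without this normalization the minimizer would only be determined on \<open>A\<close>.
\<close>

definition is_isotonic_regression ::
    "('x \<Rightarrow> 'x \<Rightarrow> bool) \<Rightarrow> ('x \<Rightarrow> real) \<Rightarrow> 'x set \<Rightarrow> ('x \<Rightarrow> real) \<Rightarrow> ('x \<Rightarrow> real) \<Rightarrow> bool" where
  "is_isotonic_regression le w A \<theta> f \<longleftrightarrow>
     f \<in> extensional A \<and> monotone_on A le (\<le>) f \<and>
     (\<forall>h. monotone_on A le (\<le>) h \<longrightarrow>
        (\<Sum>x\<in>A. (f x - \<theta> x)\<^sup>2 * w x) \<le> (\<Sum>x\<in>A. (h x - \<theta> x)\<^sup>2 * w x))"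

definition isotonic_regression ::
    "('x \<Rightarrow> 'x \<Rightarrow> bool) \<Rightarrow> ('x \<Rightarrow> real) \<Rightarrow> 'x set \<Rightarrow> ('x \<Rightarrow> real) \<Rightarrow> 'x \<Rightarrow> real" where
  "isotonic_regression le w A \<theta> = (THE f. is_isotonic_regression le w A \<theta> f)"

definition isotonic_regression_vec ::
    "('x \<Rightarrow> 'x \<Rightarrow> bool) \<Rightarrow> real ^ 'x \<Rightarrow> real ^ 'x \<Rightarrow> real ^ 'x::finite" where
  "isotonic_regression_vec le w \<theta> = (\<chi> i. isotonic_regression le (($) w) UNIV (($) \<theta>) i)"

definition level_set_regression ::
    "('x \<Rightarrow> 'x \<Rightarrow> bool) \<Rightarrow> real ^ 'x \<Rightarrow> real ^ 'x \<Rightarrow> real ^ 'x \<Rightarrow> real ^ 'x::finite" where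
  "level_set_regression le w g \<theta> =
     (\<chi> i. isotonic_regression le (($) w)
             (THE L. L \<in> comparable_level_sets le (($) g) \<and> i \<in> L) (($) \<theta>) i)"

definition diag_rate :: "real ^ 'x \<Rightarrow> nat \<Rightarrow> real ^ 'x ^ 'x::finite" where
  "diag_rate q n = (\<chi> i j. if i = j then real n powr (q $ i) else 0)"

text \<open>
  Sequences are indexed by \<open>n \<ge> 1\<close>, and the \<open>n\<close>-th random element may live on its own
  probability space. Measurability is part of both notions of convergence: the Bochner integral
  of a non-measurable function is \<open>0\<close> by convention.
\<close>

definition converges_in_prob ::
    "(nat \<Rightarrow> 'a measure) \<Rightarrow> (nat \<Rightarrow> 'a \<Rightarrow> 'v::metric_space) \<Rightarrow> 'v \<Rightarrow> bool" where
  "converges_in_prob M X c \<longleftrightarrow>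
     (\<forall>n\<ge>1. X n \<in> borel_measurable (M n)) \<and>
     (\<forall>\<epsilon>>0. (\<lambda>n. measure (M n) {\<omega> \<in> space (M n). dist (X n \<omega>) c > \<epsilon>}) \<longlonglongrightarrow> 0)"

definition converges_in_distr ::
    "(nat \<Rightarrow> 'a measure) \<Rightarrow> (nat \<Rightarrow> 'a \<Rightarrow> 'v::metric_space) \<Rightarrow> 'b measure \<Rightarrow> ('b \<Rightarrow> 'v) \<Rightarrow> bool" where
  "converges_in_distr M X N Y \<longleftrightarrow>
     (\<forall>n\<ge>1. X n \<in> borel_measurable (M n)) \<and> Y \<in> borel_measurable N \<and>
     (\<forall>f :: 'v \<Rightarrow> real. continuous_on UNIV f \<and> bounded (range f) \<longrightarrow>
        (\<lambda>n. \<integral>\<omega>. f (X n \<omega>) \<partial>M n) \<longlonglongrightarrow> (\<integral>\<omega>. f (Y \<omega>) \<partial>N))"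

text \<open>The definite descriptions above are well defined.\<close>

lemma ex1_isotonic_regression:
  fixes w \<theta> :: "'x::finite \<Rightarrow> real"
  assumes w: "\<And>x. w x > 0"
  shows "\<exists>!f. is_isotonic_regression le w A \<theta> f"
proof -
  define S :: "(real ^ 'x) set" where
    "S = {u. (\<forall>x\<in>A. \<forall>y\<in>A. le x y \<longrightarrow> u $ x / sqrt (w x) \<le> u $ y / sqrt (w y)) \<and> (\<forall>x\<in>-A. u $ x = 0)}"
  define t :: "real ^ 'x" where "t = (\<chi> x. if x \<in> A then sqrt (w x) * \<theta> x else 0)"
  define emb :: "('x \<Rightarrow> real) \<Rightarrow> real ^ 'x" where
    "emb f = (\<chi> x. if x \<in> A then sqrt (w x) * f x else 0)" for f
  have w0: "sqrt (w x) > 0" "sqrt (w x) \<noteq> 0" "w x \<noteq> 0" for x using w[of x] by auto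
  have S_Int: "S = (\<Inter>x\<in>A. \<Inter>y\<in>A. {u. le x y \<longrightarrow> u $ x / sqrt (w x) \<le> u $ y / sqrt (w y)}) \<inter> (\<Inter>x\<in>-A. {u. u $ x = 0})"
    unfolding S_def by blast
  have "closed {u::real^'x. le x y \<longrightarrow> u $ x / sqrt (w x) \<le> u $ y / sqrt (w y)}" for x y
    by (cases "le x y") (auto intro!: closed_Collect_le continuous_intros simp: w0)
  moreover have "closed {u::real^'x. u $ x = 0}" for x
    by (intro closed_Collect_eq continuous_intros)
  ultimately have cl: "closed S"
    unfolding S_Int by (intro closed_Int closed_INT ballI)
  have cv: "convex S"
    unfolding convex_def
  proof (intro ballI allI impI)
    fix u v :: "real ^ 'x" and a b :: real
    assume uv: "u \<in> S" "v \<in> S" and ab: "0 \<le> a" "0 \<le> b" "a + b = 1"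
    have "a * (u $ x / sqrt (w x)) + b * (v $ x / sqrt (w x)) \<le> a * (u $ y / sqrt (w y)) + b * (v $ y / sqrt (w y))"
      if "x \<in> A" "y \<in> A" "le x y" for x y
      using uv that ab by (intro add_mono mult_left_mono) (auto simp: S_def)
    then show "a *\<^sub>R u + b *\<^sub>R v \<in> S"
      using uv by (auto simp: S_def add_divide_distrib)
  qed
  have emb_S: "emb f \<in> S \<longleftrightarrow> monotone_on A le (\<le>) f" for f
    by (auto simp: S_def emb_def monotone_on_def w0)
  have emb_inv: "emb (\<lambda>x\<in>A. u $ x / sqrt (w x)) = u" if "u \<in> S" for u
    using that by (auto simp: vec_eq_iff emb_def S_def w0)
  have emb_inj: "f = h" if "emb f = emb h" "f \<in> extensional A" "h \<in> extensional A" for f h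
    using that w0 by (intro extensionalityI[of f A h]) (auto simp: emb_def vec_eq_iff split: if_splits)
  have sum_dist: "(\<Sum>x\<in>A. (f x - \<theta> x)\<^sup>2 * w x) = (dist t (emb f))\<^sup>2" for f
  proof -
    have sq: "(sqrt (w x))\<^sup>2 = w x" for x using w[of x] by simp
    have "(dist t (emb f))\<^sup>2 = (\<Sum>x\<in>UNIV. (dist (t $ x) (emb f $ x))\<^sup>2)"
      by (simp add: dist_vec_def L2_set_def sum_nonneg)
    also have "\<dots> = (\<Sum>x\<in>UNIV. if x \<in> A then (f x - \<theta> x)\<^sup>2 * w x else 0)"
    proof (rule sum.cong[OF refl])
      fix x
      have "(sqrt (w x) * \<theta> x - sqrt (w x) * f x)\<^sup>2 = (sqrt (w x))\<^sup>2 * (f x - \<theta> x)\<^sup>2"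
        by (simp add: power2_eq_square algebra_simps)
      then show "(dist (t $ x) (emb f $ x))\<^sup>2 = (if x \<in> A then (f x - \<theta> x)\<^sup>2 * w x else 0)"
        by (simp add: t_def emb_def dist_real_def sq mult.commute)
    qed
    finally show ?thesis by (simp add: sum.If_cases)
  qed
  have char: "is_isotonic_regression le w A \<theta> f \<longleftrightarrow>
      f \<in> extensional A \<and> emb f \<in> S \<and> (\<forall>u\<in>S. dist t (emb f) \<le> dist t u)" for f
  proof -
    have "(\<forall>h. emb h \<in> S \<longrightarrow> dist t (emb f) \<le> dist t (emb h)) \<longleftrightarrow>
        (\<forall>u\<in>S. dist t (emb f) \<le> dist t u)"
      using emb_inv by metis
    then show ?thesis
      unfolding is_isotonic_regression_def sum_dist emb_S[symmetric] by (simp add: power2_le_iff_abs_le)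
  qed
  have ne: "S \<noteq> {}" unfolding S_def by (auto intro!: exI[of _ 0])
  note cp = closest_point_exists[OF cl ne, of t]
  show ?thesis
  proof (rule ex1I)
    show "is_isotonic_regression le w A \<theta> (\<lambda>x\<in>A. closest_point S t $ x / sqrt (w x))"
      unfolding char emb_inv[OF cp(1)] using cp by auto
  next
    fix f assume "is_isotonic_regression le w A \<theta> f"
    then have f: "f \<in> extensional A" "emb f \<in> S" "\<forall>u\<in>S. dist t (emb f) \<le> dist t u"
      by (auto simp: char)
    then have "emb f = closest_point S t"
      by (intro closest_point_unique[OF cv cl])
    then show "f = (\<lambda>x\<in>A. closest_point S t $ x / sqrt (w x))"
      by (intro emb_inj) (auto simp: emb_inv[OF cp(1)] f(1))
  qed
qed

lemma partition_comparable_components: "partition_on A (comparable_components le A)"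
proof -
  let ?r = "{(x, y). x \<in> A \<and> y \<in> A \<and> comparable le x y}"
  have st: "y \<in> A" if "(x, y) \<in> ?r\<^sup>*" "x \<in> A" for x y
    using that by (induction rule: rtrancl_induct) auto
  have "sym ?r" by (auto simp: sym_def comparable_def)
  then have sy: "sym (?r\<^sup>*)" by (rule sym_rtrancl)
  have "equiv A (?r\<^sup>* \<inter> A \<times> A)"
    using sy by (auto intro!: equivI refl_onI symI transI dest: symD intro: rtrancl_trans)
  moreover have "A // ?r\<^sup>* = A // (?r\<^sup>* \<inter> A \<times> A)"
  proof -
    have "?r\<^sup>* `` {x} = (?r\<^sup>* \<inter> A \<times> A) `` {x}" if "x \<in> A" for x
      using st that by blast
    then show ?thesis unfolding quotient_def by (metis (mono_tags, lifting) SUP_cong)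
  qed
  ultimately show ?thesis
    unfolding comparable_components_def by (simp only: partition_on_quotient)
qed

lemma partition_comparable_level_sets: "partition_on UNIV (comparable_level_sets le g)"
proof -
  note P = partition_comparable_components[of _ le]
  let ?C = "comparable_components le"
  have sub: "L \<subseteq> A" if "L \<in> ?C A" for L A
    using partition_onD1[OF P[of A]] that by blast
  have "\<Union> (comparable_level_sets le g) = UNIV"
  proof -
    have "x \<in> \<Union> (comparable_level_sets le g)" for x
    proof -
      obtain V where V: "V \<in> ?C UNIV" "x \<in> V" using partition_onD1[OF P[of UNIV]] by blast
      then obtain L where "L \<in> ?C {y \<in> V. g y = g x}" "x \<in> L"
        using partition_onD1[OF P[of "{y \<in> V. g y = g x}"]] by blast
      then show ?thesis using V unfolding comparable_level_sets_def by blast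
    qed
    then show ?thesis by blast
  qed
  moreover have "disjoint (comparable_level_sets le g)"
  proof (rule disjointI, rule ccontr)
    fix L L' assume L: "L \<in> comparable_level_sets le g" and L': "L' \<in> comparable_level_sets le g"
      and ne: "L \<noteq> L'" and "L \<inter> L' \<noteq> {}"
    then obtain x where x: "x \<in> L" "x \<in> L'" by blast
    obtain V c where V: "V \<in> ?C UNIV" "L \<in> ?C {x \<in> V. g x = c}"
      using L unfolding comparable_level_sets_def by blast
    obtain V' c' where V': "V' \<in> ?C UNIV" "L' \<in> ?C {x \<in> V'. g x = c'}"
      using L' unfolding comparable_level_sets_def by blast
    have "x \<in> V" "x \<in> V'" "g x = c" "g x = c'"
      using sub[OF V(2)] sub[OF V'(2)] x by auto
    then have eq: "V = V'" "c = c'"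
      using disjointD[OF partition_onD2[OF P[of UNIV]] V(1) V'(1)] by auto
    show False
      using disjointD[OF partition_onD2[OF P] V(2)] V'(2) ne x unfolding eq by blast
  qed
  moreover have "{} \<notin> comparable_level_sets le g"
    unfolding comparable_level_sets_def using partition_onD3[OF P] by blast
  ultimately show ?thesis by (auto intro: partition_onI simp: partition_on_def)
qed

lemma ex1_comparable_level_set: "\<exists>!L. L \<in> comparable_level_sets le g \<and> x \<in> L"
proof (rule ex_ex1I)
  note P = partition_comparable_level_sets[of le g]
  show "\<exists>L. L \<in> comparable_level_sets le g \<and> x \<in> L"
    using partition_onD1[OF P] by blast
  show "L = L'" if "L \<in> comparable_level_sets le g \<and> x \<in> L"
    "L' \<in> comparable_level_sets le g \<and> x \<in> L'" for L L'
    using disjointD[OF partition_onD2[OF P], of L L'] that by blast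
qed

end

theory Submission
  imports Defs
begin

text \<open>
  Exchanging minima and maxima of two regressions shows that isotonic regression is
  order preserving and commutes with adding constants; hence it respects bounds and is
  1-Lipschitz for the maximum norm. If \<open>\<theta>\<close> is uniformly closer to \<open>g\<close> than half the smallest gap
  between values of \<open>g\<close>, gluing the regressions over the comparable level sets therefore gives an
  isotonic function, which must be the regression of \<open>\<theta>\<close> over the whole set. Since \<open>g\<close> and the
  rate are constant on each level set, with high probability the rescaled regression error is the
  image of the rescaled estimation error under the continuous map \<open>\<phi>\<close>, and the continuous mapping
  theorem applies.
\<close>

section \<open>Isotonic regression over a fixed set: uniqueness, comparison, equivariance,
  continuity\<close>

lemma is_isotonic_regression_isotonic_regression:
  fixes w \<theta> :: "'x::finite \<Rightarrow> real"
  assumes "\<And>x. w x > 0"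
  shows "is_isotonic_regression le w A \<theta> (isotonic_regression le w A \<theta>)"
  unfolding isotonic_regression_def by (rule theI'[OF ex1_isotonic_regression[of w, OF assms]])

lemma isotonic_regression_eqI:
  fixes w \<theta> :: "'x::finite \<Rightarrow> real"
  assumes "\<And>x. w x > 0" "is_isotonic_regression le w A \<theta> f"
  shows "isotonic_regression le w A \<theta> = f"
  unfolding isotonic_regression_def
  by (intro the1_equality ex1_isotonic_regression assms)

lemma monotone_on_isotonic_regression:
  fixes w \<theta> :: "'x::finite \<Rightarrow> real"
  assumes "\<And>x. w x > 0"
  shows "monotone_on A le (\<le>) (isotonic_regression le w A \<theta>)"
  using is_isotonic_regression_isotonic_regression[of w, OF assms]
  by (simp add: is_isotonic_regression_def)

lemma isotonic_regression_minimal: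
  fixes w \<theta> :: "'x::finite \<Rightarrow> real"
  assumes "\<And>x. w x > 0" "monotone_on A le (\<le>) h"
  shows "(\<Sum>x\<in>A. (isotonic_regression le w A \<theta> x - \<theta> x)\<^sup>2 * w x)
           \<le> (\<Sum>x\<in>A. (h x - \<theta> x)\<^sup>2 * w x)"
  using is_isotonic_regression_isotonic_regression[of w, OF assms(1)] assms(2)
  by (simp add: is_isotonic_regression_def)

text \<open>Uniqueness for candidates that need not be \<open>undefined\<close> outside
  \<open>A\<close>: the objective and isotonicity only see values on \<open>A\<close>, so
  restricting \<open>h\<close> yields the normalized minimizer.\<close>

lemma isotonic_regression_eq_on:
  fixes w \<theta> :: "'x::finite \<Rightarrow> real"
  assumes w: "\<And>x. w x > 0" and h: "monotone_on A le (\<le>) h"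
    and min: "\<And>k. monotone_on A le (\<le>) k \<Longrightarrow>
      (\<Sum>x\<in>A. (h x - \<theta> x)\<^sup>2 * w x) \<le> (\<Sum>x\<in>A. (k x - \<theta> x)\<^sup>2 * w x)"
    and x: "x \<in> A"
  shows "isotonic_regression le w A \<theta> x = h x"
proof -
  have "is_isotonic_regression le w A \<theta> (restrict h A)"
    using h min by (auto simp: is_isotonic_regression_def monotone_on_def)
  from isotonic_regression_eqI[of w, OF w this] x show ?thesis
    by simp
qed

text \<open>The functions \<open>l\<close> and \<open>u\<close> are isotonic as a minimum and a
  maximum of (shifted) isotonic functions, and together they cost no more than \<open>f\<close> and
  \<open>f'\<close>. Since \<open>u\<close> cannot beat \<open>f'\<close> for \<theta>',
  \<open>l\<close> must be as good as \<open>f\<close> for \<theta>, and uniqueness gives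
  \<open>f = l\<close>. Taking \<open>d = 0\<close> gives order preservation; a constant on one side
  gives bounds.\<close>

lemma isotonic_regression_mono_shift:
  fixes w \<theta> \<theta>' :: "'x::finite \<Rightarrow> real"
  assumes w: "\<And>x. w x > 0" and le: "\<And>x. x \<in> A \<Longrightarrow> \<theta> x \<le> \<theta>' x + d" and x: "x \<in> A"
  shows "isotonic_regression le w A \<theta> x \<le> isotonic_regression le w A \<theta>' x + d"
proof -
  define f where "f = isotonic_regression le w A \<theta>"
  define f' where "f' = isotonic_regression le w A \<theta>'"
  \<comment> \<open>Where \<open>f\<close> exceeds \<open>f' + d\<close>, the two regressions trade
    values up to the shift: \<open>l = f' + d\<close> and \<open>u = f - d\<close>. Elsewhere
    \<open>l = f\<close> and \<open>u = f'\<close>.\<close>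
  define l where "l x = min (f x) (f' x + d)" for x
  define u where "u x = max (f x - d) (f' x)" for x
  have f: "monotone_on A le (\<le>) f" and f': "monotone_on A le (\<le>) f'"
    unfolding f_def f'_def using w by (auto intro: monotone_on_isotonic_regression)
  have l: "monotone_on A le (\<le>) l" and u: "monotone_on A le (\<le>) u"
    using f f' unfolding monotone_on_def l_def u_def by (fastforce simp: min_def max_def)+
  have swap: "(l x - \<theta> x)\<^sup>2 * w x + (u x - \<theta>' x)\<^sup>2 * w x
      \<le> (f x - \<theta> x)\<^sup>2 * w x + (f' x - \<theta>' x)\<^sup>2 * w x" if "x \<in> A" for x
  proof (cases "f x \<le> f' x + d")
    case True
    then show ?thesis by (simp add: l_def u_def)
  next
    case False
    \<comment> \<open>Twice this product is exactly the decrease of the unweighted squared error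
      caused by the exchange.\<close>
    have "(f x - (f' x + d)) * (\<theta>' x + d - \<theta> x) \<ge> 0"
      using False le[OF that] by simp
    then have "(f' x + d - \<theta> x)\<^sup>2 + (f x - d - \<theta>' x)\<^sup>2 \<le> (f x - \<theta> x)\<^sup>2 + (f' x - \<theta>' x)\<^sup>2"
      by (simp add: power2_eq_square algebra_simps)
    then show ?thesis
      using False w[of x] by (simp add: l_def u_def flip: distrib_right)
  qed
  have "(\<Sum>x\<in>A. (l x - \<theta> x)\<^sup>2 * w x) + (\<Sum>x\<in>A. (u x - \<theta>' x)\<^sup>2 * w x)
      \<le> (\<Sum>x\<in>A. (f x - \<theta> x)\<^sup>2 * w x) + (\<Sum>x\<in>A. (f' x - \<theta>' x)\<^sup>2 * w x)"
    unfolding sum.distrib[symmetric] by (intro sum_mono swap)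
  moreover have "(\<Sum>x\<in>A. (f' x - \<theta>' x)\<^sup>2 * w x) \<le> (\<Sum>x\<in>A. (u x - \<theta>' x)\<^sup>2 * w x)"
    unfolding f'_def by (rule isotonic_regression_minimal[of w, OF w u])
  ultimately have "(\<Sum>x\<in>A. (l x - \<theta> x)\<^sup>2 * w x) \<le> (\<Sum>x\<in>A. (f x - \<theta> x)\<^sup>2 * w x)"
    by linarith
  also have "\<dots> \<le> (\<Sum>x\<in>A. (k x - \<theta> x)\<^sup>2 * w x)" if "monotone_on A le (\<le>) k" for k
    unfolding f_def by (rule isotonic_regression_minimal[of w, OF w that])
  finally have "f x = l x"
    unfolding f_def by (intro isotonic_regression_eq_on[of w, OF w l _ x])
  then show ?thesis by (simp add: l_def f_def f'_def)
qed

lemma isotonic_regression_const: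
  fixes w :: "'x::finite \<Rightarrow> real"
  assumes "\<And>x. w x > 0" "x \<in> A"
  shows "isotonic_regression le w A (\<lambda>_. c) x = c"
  using isotonic_regression_eq_on[of w A le "\<lambda>_. c" "\<lambda>_. c" x] assms
  by (simp add: monotone_on_def sum_nonneg less_imp_le)

text \<open>As \<open>a > 0\<close>, the substitution of \<open>k / a + c\<close> for
  \<open>k\<close> preserves isotonicity, and it divides the objective by the square of
  \<open>a\<close>. Minimizers therefore correspond.\<close>

lemma isotonic_regression_affine:
  fixes w \<theta> :: "'x::finite \<Rightarrow> real"
  assumes w: "\<And>x. w x > 0" and a: "a > 0" and x: "x \<in> A"
    and \<theta>': "\<And>x. x \<in> A \<Longrightarrow> \<theta>' x = a * (\<theta> x - c)"
  shows "isotonic_regression le w A \<theta>' x = a * (isotonic_regression le w A \<theta> x - c)"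
proof (rule isotonic_regression_eq_on[of w, OF w _ _ x])
  let ?f = "isotonic_regression le w A \<theta>"
  show "monotone_on A le (\<le>) (\<lambda>x. a * (?f x - c))"
    using monotone_on_isotonic_regression[of w A le \<theta>] w a by (simp add: monotone_on_def)
  fix k :: "'x \<Rightarrow> real" assume k: "monotone_on A le (\<le>) k"
  have k': "monotone_on A le (\<le>) (\<lambda>x. k x / a + c)"
    using k a by (auto simp: monotone_on_def divide_right_mono)
  have "(\<Sum>x\<in>A. (a * (?f x - c) - \<theta>' x)\<^sup>2 * w x) = a\<^sup>2 * (\<Sum>x\<in>A. (?f x - \<theta> x)\<^sup>2 * w x)"
    unfolding sum_distrib_left
    by (rule sum.cong) (auto simp: \<theta>' power2_eq_square algebra_simps)
  also have "\<dots> \<le> a\<^sup>2 * (\<Sum>x\<in>A. (k x / a + c - \<theta> x)\<^sup>2 * w x)"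
    by (intro mult_left_mono isotonic_regression_minimal[of w, OF w k']) auto
  also have "\<dots> = (\<Sum>x\<in>A. (k x - \<theta>' x)\<^sup>2 * w x)"
    unfolding sum_distrib_left
  proof (rule sum.cong)
    fix x assume "x \<in> A"
    have "k x - \<theta>' x = a * (k x / a + c - \<theta> x)"
      using a by (simp add: \<theta>'[OF \<open>x \<in> A\<close>] field_simps)
    then show "a\<^sup>2 * ((k x / a + c - \<theta> x)\<^sup>2 * w x) = (k x - \<theta>' x)\<^sup>2 * w x"
      by (simp add: power_mult_distrib)
  qed simp
  finally show "(\<Sum>x\<in>A. (a * (?f x - c) - \<theta>' x)\<^sup>2 * w x) \<le> (\<Sum>x\<in>A. (k x - \<theta>' x)\<^sup>2 * w x)" .
qed

text \<open>Each coordinate is 1-Lipschitz: apply the shift comparison in both directions with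
  \<open>d\<close> the Euclidean distance, which dominates every coordinate difference.\<close>

lemma continuous_on_isotonic_regression:
  fixes w :: "'x::finite \<Rightarrow> real"
  assumes w: "\<And>x. w x > 0" and i: "i \<in> A"
  shows "continuous_on UNIV (\<lambda>\<theta> :: real ^ 'x. isotonic_regression le w A (($) \<theta>) i)"
proof (rule lipschitz_on_continuous_on[OF lipschitz_onI[where L = 1]])
  have *: "isotonic_regression le w A (($) \<theta>) i
      \<le> isotonic_regression le w A (($) \<theta>') i + dist \<theta> \<theta>'" for \<theta> \<theta>' :: "real ^ 'x"
  proof (rule isotonic_regression_mono_shift[of w, OF w _ i])
    fix x
    have "\<theta> $ x - \<theta>' $ x \<le> dist \<theta> \<theta>'"
      using component_le_norm_cart[of "\<theta> - \<theta>'" x] by (simp add: dist_norm)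
    then show "\<theta> $ x \<le> \<theta>' $ x + dist \<theta> \<theta>'" by simp
  qed
  show "dist (isotonic_regression le w A (($) \<theta>) i) (isotonic_regression le w A (($) \<theta>') i)
      \<le> 1 * dist \<theta> \<theta>'" for \<theta> \<theta>' :: "real ^ 'x"
    using *[of \<theta> \<theta>'] *[of \<theta>' \<theta>] by (simp add: dist_real_def dist_commute abs_le_iff)
qed simp

section \<open>Structure of comparable level sets and the gap between values of
  \<open>g\<close>\<close>

lemma comparable_components_subset: "B \<in> comparable_components le A \<Longrightarrow> B \<subseteq> A"
  using partition_onD1[OF partition_comparable_components[of A le]] by blast

lemma comparable_components_closed:
  assumes "B \<in> comparable_components le A" "x \<in> B" "x \<in> A" "y \<in> A" "comparable le x y"
  shows "y \<in> B"
  using assms unfolding comparable_components_def quotient_def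
  by (auto intro: rtrancl_into_rtrancl)

text \<open>Comparability keeps \<open>y\<close> in the component \<open>V\<close> of the whole set;
  equality of values then keeps it in the component of the level set. Hence comparable elements in
  different comparable level sets have different values of \<open>g\<close>.\<close>

lemma comparable_level_set_closed:
  assumes L: "L \<in> comparable_level_sets le g" "x \<in> L" and xy: "comparable le x y" "g x = g y"
  shows "y \<in> L"
proof -
  obtain V c where V: "V \<in> comparable_components le UNIV"
    and LV: "L \<in> comparable_components le {x \<in> V. g x = c}"
    using L unfolding comparable_level_sets_def by blast
  have x: "x \<in> {x \<in> V. g x = c}"
    using comparable_components_subset[OF LV] L(2) by blast
  then have "y \<in> V"
    using comparable_components_closed[OF V] xy by auto
  then show ?thesis
    using comparable_components_closed[OF LV L(2) x] x xy by auto
qed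

lemma comparable_level_set_const:
  assumes "L \<in> comparable_level_sets le g" "x \<in> L" "y \<in> L"
  shows "g x = g y"
proof -
  obtain V c where "L \<in> comparable_components le {x \<in> V. g x = c}"
    using assms unfolding comparable_level_sets_def by blast
  then have "L \<subseteq> {x \<in> V. g x = c}"
    by (rule comparable_components_subset)
  then show ?thesis using assms by auto
qed

text \<open>The factor 2 leaves room for an error of \<delta> at both the lower and the upper value
  without reversing their order.\<close>

lemma finite_range_gap:
  fixes g :: "'x::finite \<Rightarrow> real"
  obtains \<delta> where "\<delta> > 0" "\<And>x y. g x < g y \<Longrightarrow> g x + 2 * \<delta> \<le> g y"
proof
  \<comment> \<open>The element 1 keeps \<open>D\<close> nonempty when \<open>g\<close> is constant,
    so that \<open>Min D\<close> is a positive number in every case.\<close>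
  define D where "D = insert 1 ((\<lambda>(x, y). g y - g x) ` {(x, y). g x < g y})"
  have D: "finite D" "D \<noteq> {}" "\<And>d. d \<in> D \<Longrightarrow> d > 0" unfolding D_def by auto
  then show "Min D / 2 > 0" by simp
  fix x y assume "g x < g y"
  then have "g y - g x \<in> D" by (force simp: D_def)
  then show "g x + 2 * (Min D / 2) \<le> g y" using Min_le[OF D(1)] by force
qed

section \<open>Decomposition of the regression near \<open>g\<close> into regressions over the level
  sets\<close>

definition level_set :: "('x \<Rightarrow> 'x \<Rightarrow> bool) \<Rightarrow> ('x \<Rightarrow> real) \<Rightarrow> 'x \<Rightarrow> 'x set" where
  "level_set le g i = (THE L. L \<in> comparable_level_sets le g \<and> i \<in> L)"

lemma level_set_mem:
  "level_set le g i \<in> comparable_level_sets le g" "i \<in> level_set le g i"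
  using theI'[OF ex1_comparable_level_set[of le g i]] unfolding level_set_def by auto

lemma level_set_eqI: "L \<in> comparable_level_sets le g \<Longrightarrow> i \<in> L \<Longrightarrow> level_set le g i = L"
  unfolding level_set_def by (rule the1_equality[OF ex1_comparable_level_set]) simp

lemma level_set_regression_nth:
  "level_set_regression le w g \<theta> $ i
     = isotonic_regression le (($) w) (level_set le (($) g) i) (($) \<theta>) i"
  by (simp add: level_set_regression_def level_set_def)

text \<open>The glued function is isotonic inside each level set by construction and across level
  sets by the gap. The objective is a sum over the partition, so minimality on every piece gives
  global minimality.\<close>

lemma isotonic_regression_vec_eq_level_set_regression:
  fixes w g \<theta> :: "real ^ 'x::finite"
  assumes w: "\<And>i. w $ i > 0" and g: "monotone_on UNIV le (\<le>) (($) g)"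
    and gap: "\<And>x y. g $ x < g $ y \<Longrightarrow> g $ x + 2 * \<delta> \<le> g $ y"
    and near: "\<And>x. \<bar>\<theta> $ x - g $ x\<bar> \<le> \<delta>"
  shows "isotonic_regression_vec le w \<theta> = level_set_regression le w g \<theta>"
proof -
  let ?P = "comparable_level_sets le (($) g)"
  let ?r = "\<lambda>L. isotonic_regression le (($) w) L (($) \<theta>)"
  let ?h = "\<lambda>i. level_set_regression le w g \<theta> $ i"
  note part = partition_comparable_level_sets[of le "($) g"]
  have h: "?h i = ?r L i" if "L \<in> ?P" "i \<in> L" for L i
    using that by (simp add: level_set_regression_nth level_set_eqI)
  \<comment> \<open>On the level set of \<open>i\<close>, \<theta> lies within \<delta> of the
    constant \<open>g $ i\<close>. A constant is its own regression, so comparing with it in both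
    directions transfers the bound to the regression.\<close>
  have upper: "?h i \<le> g $ i + \<delta>" and lower: "g $ i \<le> ?h i + \<delta>" for i
  proof -
    let ?L = "level_set le (($) g) i"
    let ?c = "isotonic_regression le (($) w) ?L (\<lambda>_. g $ i)"
    have L: "i \<in> ?L" by (rule level_set_mem)
    have gc: "g $ x = g $ i" if "x \<in> ?L" for x
      using comparable_level_set_const[OF level_set_mem(1) that L] .
    have c: "?c i = g $ i" by (rule isotonic_regression_const[of "($) w", OF w L])
    have "?r ?L i \<le> ?c i + \<delta>"
    proof (rule isotonic_regression_mono_shift[of "($) w", OF w _ L])
      show "\<theta> $ x \<le> g $ i + \<delta>" if "x \<in> ?L" for x
        using near[of x] gc[OF that] by (simp add: abs_le_iff)
    qed
    then show "?h i \<le> g $ i + \<delta>" by (simp add: c level_set_regression_nth)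
    have "?c i \<le> ?r ?L i + \<delta>"
    proof (rule isotonic_regression_mono_shift[of "($) w", OF w _ L])
      show "g $ i \<le> \<theta> $ x + \<delta>" if "x \<in> ?L" for x
        using near[of x] gc[OF that] by (simp add: abs_le_iff)
    qed
    then show "g $ i \<le> ?h i + \<delta>" by (simp add: c level_set_regression_nth)
  qed
  have mono: "monotone_on UNIV le (\<le>) ?h"
  proof (rule monotone_onI)
    fix x y assume xy: "le x y"
    show "?h x \<le> ?h y"
    proof (cases "g $ x = g $ y")
      case True
      let ?L = "level_set le (($) g) x"
      note L = level_set_mem[where le = le and g = "($) g" and i = x]
      have y: "y \<in> ?L"
        using comparable_level_set_closed[OF L] xy True by (simp add: comparable_def)
      have "?r ?L x \<le> ?r ?L y"
        using monotone_on_isotonic_regression[of "($) w" ?L le] w L y xy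
        by (auto simp: monotone_on_def)
      then show ?thesis
        by (simp only: h[OF L] h[OF L(1) y])
    next
      \<comment> \<open>Here \<open>?h x\<close> is at most \<open>g $ x + \<delta>\<close>, which
        by the gap is at most \<open>g $ y - \<delta>\<close>, which is at most
        \<open>?h y\<close>.\<close>
      case False
      then have "g $ x < g $ y"
        using monotone_onD[OF g _ _ xy] by simp
      then show ?thesis
        using gap[of x y] upper[of x] lower[of y] by linarith
    qed
  qed
  have split: "sum k UNIV = (\<Sum>L\<in>?P. sum k L)" for k :: "'x \<Rightarrow> real"
  proof -
    have "sum k (\<Union> ?P) = (\<Sum>L\<in>?P. sum k L)"
      using sum.Union_disjoint[of ?P k] partition_onD2[OF part]
      by (auto simp: disjoint_def)
    then show ?thesis using partition_onD1[OF part] by simp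
  qed
  \<comment> \<open>A globally isotonic competitor is isotonic on each level set, so it already
    loses piece by piece.\<close>
  have min: "(\<Sum>x\<in>UNIV. (?h x - \<theta> $ x)\<^sup>2 * w $ x) \<le> (\<Sum>x\<in>UNIV. (k x - \<theta> $ x)\<^sup>2 * w $ x)"
    if k: "monotone_on UNIV le (\<le>) k" for k
    unfolding split
  proof (rule sum_mono)
    fix L assume L: "L \<in> ?P"
    have "(\<Sum>x\<in>L. (?h x - \<theta> $ x)\<^sup>2 * w $ x) = (\<Sum>x\<in>L. (?r L x - \<theta> $ x)\<^sup>2 * w $ x)"
      by (intro sum.cong) (simp_all add: h[OF L])
    also have "\<dots> \<le> (\<Sum>x\<in>L. (k x - \<theta> $ x)\<^sup>2 * w $ x)"
      by (rule isotonic_regression_minimal[of "($) w", OF w monotone_on_subset[OF k]]) simp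
    finally show "(\<Sum>x\<in>L. (?h x - \<theta> $ x)\<^sup>2 * w $ x) \<le> (\<Sum>x\<in>L. (k x - \<theta> $ x)\<^sup>2 * w $ x)" .
  qed
  show ?thesis
    unfolding isotonic_regression_vec_def
    using isotonic_regression_eq_on[of "($) w" UNIV le ?h "($) \<theta>"] w mono min
    by (simp add: vec_eq_iff)
qed

section \<open>Rescaling and continuity of the vector-valued regressions\<close>

lemma diag_rate_mult_nth: "(diag_rate q n *v v) $ i = real n powr (q $ i) * v $ i"
proof -
  have "(diag_rate q n *v v) $ i = (\<Sum>j\<in>UNIV. if i = j then real n powr (q $ i) * v $ j else 0)"
    by (simp add: matrix_vector_mult_def diag_rate_def if_distrib[of "\<lambda>x. x * _"] cong: if_cong)
  then show ?thesis by simp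
qed

text \<open>On one level set both the rate and \<open>g\<close> are constant, so centering and
  scaling form a single affine map there, with \<open>a = real n powr (q $ i)\<close> and
  \<open>c = g $ i\<close>. The hypothesis on \<open>n\<close> makes \<open>a\<close>
  positive.\<close>

lemma level_set_regression_diag_rate:
  fixes w g q \<theta> :: "real ^ 'x::finite"
  assumes w: "\<And>i. w $ i > 0" and n: "n \<ge> 1"
    and q: "\<And>L i j. L \<in> comparable_level_sets le (($) g) \<Longrightarrow> i \<in> L \<Longrightarrow> j \<in> L \<Longrightarrow> q $ i = q $ j"
  shows "level_set_regression le w g (diag_rate q n *v (\<theta> - g))
      = diag_rate q n *v (level_set_regression le w g \<theta> - g)"
proof (simp only: vec_eq_iff, intro allI)
  fix i
  let ?L = "level_set le (($) g) i"
  note L = level_set_mem[where le = le and g = "($) g" and i = i]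
  have "isotonic_regression le (($) w) ?L (($) (diag_rate q n *v (\<theta> - g))) i
      = real n powr (q $ i) * (isotonic_regression le (($) w) ?L (($) \<theta>) i - g $ i)"
  proof (rule isotonic_regression_affine[of "($) w", OF w _ L(2)])
    show "real n powr (q $ i) > 0" using n by simp
    show "(diag_rate q n *v (\<theta> - g)) $ x = real n powr (q $ i) * (\<theta> $ x - g $ i)"
      if "x \<in> ?L" for x
      using q[OF L(1) that L(2)] comparable_level_set_const[OF L(1) that L(2)]
      by (simp add: diag_rate_mult_nth)
  qed
  then show "level_set_regression le w g (diag_rate q n *v (\<theta> - g)) $ i
      = (diag_rate q n *v (level_set_regression le w g \<theta> - g)) $ i"
    by (simp add: level_set_regression_nth diag_rate_mult_nth)
qed

lemma continuous_on_level_set_regression: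
  fixes w g :: "real ^ 'x::finite"
  assumes "\<And>i. w $ i > 0"
  shows "continuous_on UNIV (level_set_regression le w g)"
  unfolding level_set_regression_def level_set_def[symmetric]
  by (intro continuous_on_vec_lambda continuous_on_isotonic_regression assms level_set_mem)

text \<open>Serves to make the regression of a random vector Borel measurable.\<close>

lemma continuous_on_isotonic_regression_vec:
  fixes w :: "real ^ 'x::finite"
  assumes "\<And>i. w $ i > 0"
  shows "continuous_on UNIV (isotonic_regression_vec le w)"
  unfolding isotonic_regression_vec_def
  by (intro continuous_on_vec_lambda continuous_on_isotonic_regression assms) simp

section \<open>Convergence in distribution: continuous mapping and replacement off small
  events\<close>

lemma converges_in_distr_continuous_mapping:
  fixes \<phi> :: "'v::metric_space \<Rightarrow> 'u::metric_space"
  assumes X: "converges_in_distr M X N Y" and \<phi>: "continuous_on UNIV \<phi>"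
  shows "converges_in_distr M (\<lambda>n \<omega>. \<phi> (X n \<omega>)) N (\<lambda>\<omega>. \<phi> (Y \<omega>))"
  unfolding converges_in_distr_def
proof (intro conjI allI impI)
  have m: "\<phi> \<in> borel_measurable borel"
    by (rule borel_measurable_continuous_onI[OF \<phi>])
  show "(\<lambda>\<omega>. \<phi> (X n \<omega>)) \<in> borel_measurable (M n)" if "n \<ge> 1" for n
    using X that measurable_compose[OF _ m] by (auto simp: converges_in_distr_def)
  show "(\<lambda>\<omega>. \<phi> (Y \<omega>)) \<in> borel_measurable N"
    using X measurable_compose[OF _ m] by (auto simp: converges_in_distr_def)
  fix f :: "'u \<Rightarrow> real" assume f: "continuous_on UNIV f \<and> bounded (range f)"
  have "continuous_on UNIV (\<lambda>x. f (\<phi> x))"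
    using f by (intro continuous_on_compose2[OF _ \<phi>, of UNIV f]) auto
  moreover have "bounded (range (\<lambda>x. f (\<phi> x)))"
    using f by (auto intro: bounded_subset)
  ultimately show "(\<lambda>n. \<integral>\<omega>. f (\<phi> (X n \<omega>)) \<partial>M n) \<longlonglongrightarrow> (\<integral>\<omega>. f (\<phi> (Y \<omega>)) \<partial>N)"
    using X unfolding converges_in_distr_def by blast
qed

text \<open>If a test function is bounded by \<open>K\<close>, its values at \<open>X' n\<close> and
  \<open>X n\<close> agree off \<open>E n\<close> and differ by at most \<open>2 * K\<close> on it.
  The expectations thus differ by at most \<open>2 * K\<close> times the vanishing probability of
  \<open>E n\<close>.\<close>

lemma converges_in_distr_transfer:
  fixes X X' :: "nat \<Rightarrow> 'a \<Rightarrow> 'v::metric_space"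
  assumes X: "converges_in_distr M X N Y"
    and M: "\<And>n. n \<ge> 1 \<Longrightarrow> prob_space (M n)"
    and X': "\<And>n. n \<ge> 1 \<Longrightarrow> X' n \<in> borel_measurable (M n)"
    and E: "\<And>n. n \<ge> 1 \<Longrightarrow> E n \<in> sets (M n)" "(\<lambda>n. measure (M n) (E n)) \<longlonglongrightarrow> 0"
    and eq: "\<And>n \<omega>. n \<ge> 1 \<Longrightarrow> \<omega> \<in> space (M n) \<Longrightarrow> \<omega> \<notin> E n \<Longrightarrow> X' n \<omega> = X n \<omega>"
  shows "converges_in_distr M X' N Y"
  unfolding converges_in_distr_def
proof (intro conjI allI impI)
  show "X' n \<in> borel_measurable (M n)" if "n \<ge> 1" for n using X' that .
  show "Y \<in> borel_measurable N" using X by (simp add: converges_in_distr_def)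
  fix f :: "'v \<Rightarrow> real" assume f: "continuous_on UNIV f \<and> bounded (range f)"
  then obtain K where K: "\<bar>f x\<bar> \<le> K" for x
    by (auto simp: bounded_iff)
  have fm: "f \<in> borel_measurable borel"
    using f by (intro borel_measurable_continuous_onI) simp
  have bound: "norm ((\<integral>\<omega>. f (X' n \<omega>) \<partial>M n) - (\<integral>\<omega>. f (X n \<omega>) \<partial>M n))
      \<le> 2 * K * measure (M n) (E n)" if n: "n \<ge> 1" for n
  proof -
    interpret prob_space "M n" using M n .
    have Xm: "X n \<in> borel_measurable (M n)" using X n by (simp add: converges_in_distr_def)
    have int: "integrable (M n) (\<lambda>\<omega>. f (Z \<omega>))" if "Z \<in> borel_measurable (M n)" for Z
      using measurable_compose[OF that fm] K
      by (intro integrable_const_bound[of _ K]) auto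
    have "(\<integral>\<omega>. f (X' n \<omega>) \<partial>M n) - (\<integral>\<omega>. f (X n \<omega>) \<partial>M n)
        = (\<integral>\<omega>. f (X' n \<omega>) - f (X n \<omega>) \<partial>M n)"
      using int[OF X'[OF n]] int[OF Xm] by simp
    also have "norm \<dots> \<le> (\<integral>\<omega>. norm (f (X' n \<omega>) - f (X n \<omega>)) \<partial>M n)"
      by (rule integral_norm_bound)
    also have "\<dots> \<le> (\<integral>\<omega>. 2 * K * indicator (E n) \<omega> \<partial>M n)"
    proof (rule integral_mono)
      show "integrable (M n) (\<lambda>\<omega>. norm (f (X' n \<omega>) - f (X n \<omega>)))"
        using int[OF X'[OF n]] int[OF Xm] by simp
      show "integrable (M n) (\<lambda>\<omega>. 2 * K * indicator (E n) \<omega>)"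
        using E(1)[OF n]
        by (intro integrable_mult_right integrable_real_indicator) (auto simp: less_top[symmetric])
      fix \<omega> assume "\<omega> \<in> space (M n)"
      then show "norm (f (X' n \<omega>) - f (X n \<omega>)) \<le> 2 * K * indicator (E n) \<omega>"
        using eq[OF n, of \<omega>] K[of "X' n \<omega>"] K[of "X n \<omega>"]
        by (cases "\<omega> \<in> E n") (auto simp: abs_le_iff)
    qed
    also have "\<dots> = 2 * K * measure (M n) (E n)"
      using E(1)[OF n] by simp
    finally show ?thesis .
  qed
  have "(\<lambda>n. (\<integral>\<omega>. f (X' n \<omega>) \<partial>M n) - (\<integral>\<omega>. f (X n \<omega>) \<partial>M n)) \<longlonglongrightarrow> 0"
  proof (rule Lim_null_comparison)
    show "\<forall>\<^sub>F n in sequentially. norm ((\<integral>\<omega>. f (X' n \<omega>) \<partial>M n) - (\<integral>\<omega>. f (X n \<omega>) \<partial>M n))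
        \<le> 2 * K * measure (M n) (E n)"
      using bound by (auto intro: eventually_sequentiallyI[of 1])
    show "(\<lambda>n. 2 * K * measure (M n) (E n)) \<longlonglongrightarrow> 0"
      using tendsto_mult_left[OF E(2), of "2 * K"] by simp
  qed
  moreover have "(\<lambda>n. \<integral>\<omega>. f (X n \<omega>) \<partial>M n) \<longlonglongrightarrow> (\<integral>\<omega>. f (Y \<omega>) \<partial>N)"
    using X f by (simp add: converges_in_distr_def)
  ultimately show "(\<lambda>n. \<integral>\<omega>. f (X' n \<omega>) \<partial>M n) \<longlonglongrightarrow> (\<integral>\<omega>. f (Y \<omega>) \<partial>N)"
    by (rule Lim_transform[rotated])
qed

theorem theorem1:
  fixes le :: "'x::finite \<Rightarrow> 'x \<Rightarrow> bool"
    and w g q :: "real ^ 'x"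
    and M :: "nat \<Rightarrow> 'a measure"
    and ghat :: "nat \<Rightarrow> 'a \<Rightarrow> real ^ 'x"
    and N :: "'b measure"
    and lam :: "'b \<Rightarrow> real ^ 'x"
  assumes "reflp le" and "transp le"
    and "\<And>i. w $ i > 0"
    and "monotone_on UNIV le (\<le>) (($) g)"
    and "\<And>n. n \<ge> 1 \<Longrightarrow> prob_space (M n)"
    and "prob_space N"
    and "\<And>n. n \<ge> 1 \<Longrightarrow> ghat n \<in> borel_measurable (M n)"
    and "lam \<in> borel_measurable N"
    and "\<And>i. q $ i > 0"
    and "\<And>L i j. L \<in> comparable_level_sets le (($) g) \<Longrightarrow> i \<in> L \<Longrightarrow> j \<in> L \<Longrightarrow> q $ i = q $ j"
    and "converges_in_prob M ghat g"
    and "converges_in_distr M (\<lambda>n \<omega>. diag_rate q n *v (ghat n \<omega> - g)) N lam"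
  shows "converges_in_distr M
           (\<lambda>n \<omega>. diag_rate q n *v (isotonic_regression_vec le w (ghat n \<omega>) - g))
           N (\<lambda>\<omega>. level_set_regression le w g (lam \<omega>))"
proof -
  note w = assms(3) and q = assms(10)
  obtain \<delta> where \<delta>: "\<delta> > 0" and gap: "\<And>x y. g $ x < g $ y \<Longrightarrow> g $ x + 2 * \<delta> \<le> g $ y"
    using finite_range_gap[of "($) g"] by blast
  \<comment> \<open>The exceptional event: outside it every coordinate of the estimator is within
    \<delta> of \<open>g\<close>, and consistency makes its probability vanish.\<close>
  define E where "E n = {\<omega> \<in> space (M n). dist (ghat n \<omega>) g > \<delta>}" for n
  show ?thesis
  proof (rule converges_in_distr_transfer)
    \<comment> \<open>The replacement sequence applies the level set regression to the rescaled
      error itself, so its limit follows from continuity.\<close>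
    show "converges_in_distr M
        (\<lambda>n \<omega>. level_set_regression le w g (diag_rate q n *v (ghat n \<omega> - g)))
        N (\<lambda>\<omega>. level_set_regression le w g (lam \<omega>))"
      by (rule converges_in_distr_continuous_mapping[OF assms(12)
            continuous_on_level_set_regression[of w, OF w]])
    show "prob_space (M n)" if "n \<ge> 1" for n using assms(5) that .
    show "(\<lambda>n. measure (M n) (E n)) \<longlonglongrightarrow> 0"
      using assms(11) \<delta> by (simp add: converges_in_prob_def E_def)
    fix n :: nat assume n: "n \<ge> 1"
    note [measurable] = assms(7)[OF n]
    show "E n \<in> sets (M n)" unfolding E_def by measurable
    have "continuous_on UNIV (\<lambda>\<theta>. diag_rate q n *v (isotonic_regression_vec le w \<theta> - g))"
      by (intro continuous_on_compose2[OF matrix_vector_mult_linear_continuous_on[of UNIV]]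
          continuous_on_diff continuous_on_const continuous_on_isotonic_regression_vec w) simp
    then show "(\<lambda>\<omega>. diag_rate q n *v (isotonic_regression_vec le w (ghat n \<omega>) - g))
        \<in> borel_measurable (M n)"
      by (intro measurable_compose[OF assms(7)[OF n]] borel_measurable_continuous_onI)
    fix \<omega> assume "\<omega> \<in> space (M n)" "\<omega> \<notin> E n"
    then have "dist (ghat n \<omega>) g \<le> \<delta>" by (simp add: E_def)
    then have near: "\<bar>ghat n \<omega> $ x - g $ x\<bar> \<le> \<delta>" for x
      using component_le_norm_cart[of "ghat n \<omega> - g" x] by (simp add: dist_norm)
    \<comment> \<open>Off \<open>E n\<close> the global regression splits over the level sets;
      equivariance then moves centering and scaling inside the level set regression.\<close>
    have "isotonic_regression_vec le w (ghat n \<omega>) = level_set_regression le w g (ghat n \<omega>)"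
      by (rule isotonic_regression_vec_eq_level_set_regression) (fact w assms(4) gap near)+
    moreover have "level_set_regression le w g (diag_rate q n *v (ghat n \<omega> - g))
        = diag_rate q n *v (level_set_regression le w g (ghat n \<omega>) - g)"
      by (rule level_set_regression_diag_rate) (fact w n q)+
    ultimately show "diag_rate q n *v (isotonic_regression_vec le w (ghat n \<omega>) - g)
        = level_set_regression le w g (diag_rate q n *v (ghat n \<omega> - g))"
      by simp
  qed
qed

end
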